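(* Let $F$ be a field, let $n>0$, and let $D=\{d_0,d_1,\dots,d_{n-1}\}$ be a set of integers with $0=d_0<d_1<\dots<d_{n-1}$; put $N=d_{n-1}+1$. Then there exist $a_0,a_1,\dots,a_{N-1}\in\{0,1\}\subseteq F$ such that, letting $A=(a_{i-j})_{0\le i,j<N}$ be the $N\times N$ lower triangular Toeplitz matrix (with the convention $a_i=0$ for $i<0$), the linear map $F[D]\to F^n$ sending $x\in F[D]$ to the last $n$ coordinates of $Ax$ (i.e. the coordinates with indices $N-n,\dots,N-1$) is injective.
   Context: $F^N$ denotes the standard $F$-vector space with basis $e_0,\dots,e_{N-1}$, with vectors viewed as column vectors indexed by $0,\dots,N-1$. $F[D]$ denotes the subspace of $F^N$ spanned by $e_{d_0},\dots,e_{d_{n-1}}$, i.e. vectors whose only possibly non-zero coordinates are at indices in $D$. Multiplication by $A$ corresponds to the convolution $(a\ast x)_i=\sum_{j+k=i,\,0\le j,k<N}a_jx_k$. The elements $0,1$ are the zero and identity of $F$. *)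

theory Defs
  imports "Jordan_Normal_Form.VS_Connect"
begin

definition lower_toeplitz :: "nat \<Rightarrow> (nat \<Rightarrow> 'a::zero) \<Rightarrow> 'a mat" where
  "lower_toeplitz N a = mat N N (\<lambda>(i, j). if j \<le> i then a (i - j) else 0)"

definition coord_subspace :: "nat \<Rightarrow> nat set \<Rightarrow> 'a::field vec set" where
  "coord_subspace N D =
     LinearCombinations.module.span class_ring (module_vec TYPE('a) N) (unit_vec N ` D)"

lemma coord_subspace_iff:
  fixes x :: "'a::field vec"
  assumes "D \<subseteq> {..<N}"
  shows "x \<in> coord_subspace N D \<longleftrightarrow>
           x \<in> carrier_vec N \<and> (\<forall>i<N. i \<notin> D \<longrightarrow> x $ i = 0)"
proof -
  interpret vec_space "TYPE('a)" N .
  let ?U = "unit_vec N ` D :: 'a vec set"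
  have finD: "finite D" using assms finite_subset by blast
  have U: "?U \<subseteq> carrier_vec N" by auto
  have finU: "finite ?U" using finD by simp
  have inj: "inj_on (unit_vec N :: nat \<Rightarrow> 'a vec) D"
  proof (rule inj_onI)
    fix i j assume "i \<in> D" "j \<in> D" and eq: "(unit_vec N i :: 'a vec) = unit_vec N j"
    then have "i < N" "j < N" using assms by auto
    moreover have "(unit_vec N i :: 'a vec) $ i = unit_vec N j $ i" using eq by simp
    ultimately show "i = j" by (auto simp: unit_vec_def split: if_splits)
  qed
  have idx: "lincomb c ?U $ i = (if i \<in> D then c (unit_vec N i) else 0)" if "i < N" for c i
  proof -
    have "lincomb c ?U $ i = (\<Sum>u\<in>?U. c u * u $ i)"
      using that U by (rule lincomb_index)
    also have "\<dots> = (\<Sum>j\<in>D. c (unit_vec N j) * unit_vec N j $ i)"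
      by (simp add: sum.reindex[OF inj])
    also have "\<dots> = (\<Sum>j\<in>D. if i = j then c (unit_vec N j) else 0)"
      using assms that by (intro sum.cong) (auto simp: unit_vec_def)
    also have "\<dots> = (if i \<in> D then c (unit_vec N i) else 0)"
      using finD by simp
    finally show ?thesis .
  qed
  have sp: "coord_subspace N D = span ?U" by (simp add: coord_subspace_def)
  show ?thesis
  proof
    assume "x \<in> coord_subspace N D"
    then obtain c where x: "x = lincomb c ?U"
      using sp finite_in_span[OF finU U, of x] by auto
    then show "x \<in> carrier_vec N \<and> (\<forall>i<N. i \<notin> D \<longrightarrow> x $ i = 0)"
      using lincomb_closed[of ?U c] U idx[of _ c] by simp
  next
    assume x: "x \<in> carrier_vec N \<and> (\<forall>i<N. i \<notin> D \<longrightarrow> x $ i = 0)"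
    define c where "c u = x $ (the_inv_into D (unit_vec N) u)" for u :: "'a vec"
    have "x = lincomb c ?U"
    proof (rule eq_vecI)
      show "dim_vec x = dim_vec (lincomb c ?U)"
        using x lincomb_dim[OF finU U] by simp
      fix i assume "i < dim_vec (lincomb c ?U)"
      then have "i < N" using lincomb_dim[OF finU U] by simp
      then show "x $ i = lincomb c ?U $ i"
        using x idx[of i c] by (simp add: c_def the_inv_into_f_f[OF inj])
    qed
    then show "x \<in> coord_subspace N D"
      unfolding sp using in_spanI[OF _ finU subset_refl] by simp
  qed
qed

end

theory Submission
  imports Defs
begin

text \<open>
  Reversing the order of the coordinates turns the claim into the statement that for every finite
  set \<open>E\<close> of naturals some 0/1 sequence \<open>a\<close> makes the square matrix with entries \<open>a (e - r)\<close>
  (\<open>r < card E\<close>, \<open>e \<in> E\<close>; zero if \<open>r > e\<close>) injective. We induct on \<open>card E\<close> and strengthen the claim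
  by \<open>a 0 = 1\<close>. If \<open>0 \<in> E\<close>, the column of \<open>0\<close> is the first unit vector, so row and column
  \<open>0\<close> can be deleted. Otherwise \<open>a (Max E)\<close> occurs only in row \<open>0\<close> and column \<open>Max E\<close>; the
  determinant is affine in it, and its slope is the determinant obtained by deleting that row and
  column, which is nonzero by induction. So at least one of the values 0 and 1 works.
\<close>

text \<open>With \<open>e = N - 1 - j\<close> and \<open>r = N - 1 - i\<close> this is coordinate
  \<open>i\<close> of the product. The guard replaces the convention for negative indices, since
  subtraction on naturals truncates.\<close>

definition rev_toeplitz_row :: "(nat \<Rightarrow> 'a::field) \<Rightarrow> nat set \<Rightarrow> (nat \<Rightarrow> 'a) \<Rightarrow> nat \<Rightarrow> 'a" where
  "rev_toeplitz_row a E x r = (\<Sum>e\<in>E. if r \<le> e then a (e - r) * x e else 0)"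

text \<open>A trivial kernel instead of a nonzero determinant, so that the induction works with
  kernel vectors alone. Values of \<open>x\<close> outside \<open>E\<close> are irrelevant.\<close>

definition rev_toeplitz_inj :: "(nat \<Rightarrow> 'a::field) \<Rightarrow> nat set \<Rightarrow> bool" where
  "rev_toeplitz_inj a E \<longleftrightarrow>
     (\<forall>x. (\<forall>r<card E. rev_toeplitz_row a E x r = 0) \<longrightarrow> (\<forall>e\<in>E. x e = 0))"

text \<open>Entries depend only on \<open>e - r\<close>, so a simultaneous shift of rows and columns
  changes nothing.\<close>

lemma rev_toeplitz_row_Suc_image:
  "rev_toeplitz_row a (Suc ` T) x (Suc r) = rev_toeplitz_row a T (\<lambda>e. x (Suc e)) r"
  by (auto simp: rev_toeplitz_row_def sum.reindex intro!: sum.cong)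

lemma rev_toeplitz_row_insert:
  assumes "finite S" "m \<notin> S"
  shows "rev_toeplitz_row a (insert m S) x r =
           (if r \<le> m then a (m - r) * x m else 0) + rev_toeplitz_row a S x r"
  using assms by (simp add: rev_toeplitz_row_def)

lemma rev_toeplitz_row_fun_upd_eq:
  assumes "\<And>e. e \<in> S \<Longrightarrow> e < m + r"
  shows "rev_toeplitz_row (a(m := c)) S x r = rev_toeplitz_row a S x r"
  unfolding rev_toeplitz_row_def using assms by (intro sum.cong) fastforce+

lemma rev_toeplitz_row_diff_scaled:
  "rev_toeplitz_row a S (\<lambda>e. s * x e - t * y e) r =
     s * rev_toeplitz_row a S x r - t * rev_toeplitz_row a S y r"
  unfolding rev_toeplitz_row_def sum_distrib_left sum_subtractf[symmetric]
  by (intro sum.cong) (auto simp: algebra_simps)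

text \<open>The minor left after deleting row 0 is the system of \<open>T\<close>; both induction
  cases fall back on it.\<close>

lemma rev_toeplitz_inj_Suc_imageD:
  assumes "rev_toeplitz_inj a T"
    and "\<And>r. r < card T \<Longrightarrow> rev_toeplitz_row a (Suc ` T) x (Suc r) = 0"
    and "e \<in> Suc ` T"
  shows "x e = 0"
  using assms unfolding rev_toeplitz_inj_def rev_toeplitz_row_Suc_image by blast

text \<open>Column 0 meets row 0 only, so the lower rows determine \<open>x\<close> on the shifted
  set and row 0 then yields \<open>x 0\<close>.\<close>

lemma rev_toeplitz_inj_insert_0:
  assumes T: "finite T" and "rev_toeplitz_inj a T" and "a 0 = 1"
  shows "rev_toeplitz_inj a (insert 0 (Suc ` T))"
  unfolding rev_toeplitz_inj_def
proof (intro allI impI)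
  fix x assume x: "\<forall>r<card (insert 0 (Suc ` T)). rev_toeplitz_row a (insert 0 (Suc ` T)) x r = 0"
  have card: "card (insert 0 (Suc ` T)) = Suc (card T)"
    using T by (simp add: card_image)
  have row: "(if r \<le> 0 then a (0 - r) * x 0 else 0) + rev_toeplitz_row a (Suc ` T) x r = 0"
    if "r \<le> card T" for r
    using x that T by (subst rev_toeplitz_row_insert[symmetric]) (auto simp: card)
  have "rev_toeplitz_row a (Suc ` T) x (Suc r) = 0" if "r < card T" for r
    using row[of "Suc r"] that by simp
  then have z: "x e = 0" if "e \<in> Suc ` T" for e
    using rev_toeplitz_inj_Suc_imageD[OF assms(2) _ that] by blast
  then have "rev_toeplitz_row a (Suc ` T) x 0 = 0"
    by (auto simp: rev_toeplitz_row_def intro: sum.neutral)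
  then have "x 0 = 0" using row[of 0] \<open>a 0 = 1\<close> by simp
  then show "\<forall>e\<in>insert 0 (Suc ` T). x e = 0" using z by blast
qed

text \<open>A determinant-free form of the affine argument: if both values failed, kernel vectors
  for 0 and 1 would be proportional by injectivity for \<open>T\<close>, but row 0 tells the two
  values apart.\<close>

lemma rev_toeplitz_inj_insert_greater:
  assumes T: "finite T" and inj: "rev_toeplitz_inj a T" and less: "\<And>e. e \<in> T \<Longrightarrow> Suc e < m"
  shows "\<exists>c\<in>{0, 1}. rev_toeplitz_inj (a(m := c)) (insert m (Suc ` T))"
proof (rule ccontr)
  let ?S = "Suc ` T"
  assume neg: "\<not> ?thesis"
  have S: "finite ?S" "m \<notin> ?S" using T less by auto
  have card: "card (insert m ?S) = Suc (card T)" using S by (simp add: card_image)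
  \<comment> \<open>All elements of \<open>?S\<close> lie below \<open>m\<close>, so
    \<open>c\<close> enters only through column \<open>m\<close> in row 0.\<close>
  have row: "rev_toeplitz_row (a(m := c)) (insert m ?S) x r =
      (if r = 0 then c * x m else if r \<le> m then a (m - r) * x m else 0) + rev_toeplitz_row a ?S x r"
    for c x r
  proof -
    have "e < m + r" if "e \<in> ?S" for e using that less by (auto simp: trans_less_add1)
    then have "rev_toeplitz_row (a(m := c)) ?S x r = rev_toeplitz_row a ?S x r"
      by (rule rev_toeplitz_row_fun_upd_eq)
    then show ?thesis by (auto simp: rev_toeplitz_row_insert[OF S])
  qed
  have "\<exists>x. (\<forall>r\<le>card T. rev_toeplitz_row (a(m := c)) (insert m ?S) x r = 0) \<and> x m \<noteq> 0"
    if "c \<in> {0, 1}" for c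
  proof -
    have "\<not> rev_toeplitz_inj (a(m := c)) (insert m ?S)" using neg that by blast
    then obtain x where x: "\<And>r. r \<le> card T \<Longrightarrow> rev_toeplitz_row (a(m := c)) (insert m ?S) x r = 0"
      and nz: "\<exists>e\<in>insert m ?S. x e \<noteq> 0"
      unfolding rev_toeplitz_inj_def card less_Suc_eq_le by blast
    \<comment> \<open>A kernel vector vanishing at \<open>m\<close> would solve the system of
      \<open>T\<close> and hence be zero.\<close>
    have "x m \<noteq> 0"
    proof
      assume 0: "x m = 0"
      have "rev_toeplitz_row a ?S x (Suc r) = 0" if "r < card T" for r
        using x[of "Suc r"] that 0 by (simp add: row split: if_splits)
      then have "x e = 0" if "e \<in> ?S" for e
        using rev_toeplitz_inj_Suc_imageD[OF inj _ that] by blast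
      then show False using nz 0 by blast
    qed
    then show ?thesis using x by blast
  qed
  from this[of 0] this[of 1] obtain x y
    where x: "\<And>r. r \<le> card T \<Longrightarrow> rev_toeplitz_row (a(m := 0)) (insert m ?S) x r = 0" "x m \<noteq> 0"
      and y: "\<And>r. r \<le> card T \<Longrightarrow> rev_toeplitz_row (a(m := 1)) (insert m ?S) y r = 0" "y m \<noteq> 0"
    by auto
  \<comment> \<open>The coefficients make \<open>z m = 0\<close>, so column \<open>m\<close> cancels
    in all rows below row 0.\<close>
  define z where "z = (\<lambda>e. y m * x e - x m * y e)"
  have zrow: "rev_toeplitz_row a ?S z r = y m * rev_toeplitz_row a ?S x r - x m * rev_toeplitz_row a ?S y r" for r
    unfolding z_def by (rule rev_toeplitz_row_diff_scaled)
  have "rev_toeplitz_row a ?S z (Suc r) = 0" if "r < card T" for r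
  proof -
    define k where "k = (if Suc r \<le> m then a (m - Suc r) else 0)"
    have "k * x m + rev_toeplitz_row a ?S x (Suc r) = 0" "k * y m + rev_toeplitz_row a ?S y (Suc r) = 0"
      using x(1)[of "Suc r"] y(1)[of "Suc r"] that by (auto simp: row k_def split: if_splits)
    then have "rev_toeplitz_row a ?S x (Suc r) = - (k * x m)" "rev_toeplitz_row a ?S y (Suc r) = - (k * y m)"
      by (simp_all add: eq_neg_iff_add_eq_0 add.commute)
    then show ?thesis by (simp add: zrow)
  qed
  then have "z e = 0" if "e \<in> ?S" for e
    using rev_toeplitz_inj_Suc_imageD[OF inj _ that] by blast
  then have "rev_toeplitz_row a ?S z 0 = 0"
    by (auto simp: rev_toeplitz_row_def intro: sum.neutral)
  \<comment> \<open>For \<open>c = 0\<close>, row 0 does not contain \<open>x m\<close>; for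
    \<open>c = 1\<close> it contains \<open>y m\<close> with coefficient 1, which is forced to
    vanish.\<close>
  moreover have "rev_toeplitz_row a ?S x 0 = 0" using x(1)[of 0] by (simp add: row)
  ultimately have "rev_toeplitz_row a ?S y 0 = 0" using x(2) by (simp add: zrow)
  then show False using y(1)[of 0] y(2) by (simp add: row)
qed

lemma exists_rev_toeplitz_inj:
  assumes "finite E"
  shows "\<exists>a :: nat \<Rightarrow> 'a::field. range a \<subseteq> {0, 1} \<and> a 0 = 1 \<and> rev_toeplitz_inj a E"
  using assms
proof (induction "card E" arbitrary: E)
  case 0
  then show ?case by (intro exI[of _ "\<lambda>_. 1"]) (auto simp: rev_toeplitz_inj_def)
next
  case (Suc n)
  \<comment> \<open>Either choice leaves only positive elements, so taking predecessors is undone by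
    \<open>Suc\<close>; the maximum also ensures \<open>Suc e < m\<close> on
    \<open>T\<close>.\<close>
  define m where "m = (if 0 \<in> E then 0 else Max E)"
  have ne: "E \<noteq> {}" using Suc.hyps by auto
  have m: "m \<in> E" using Suc.prems ne by (simp add: m_def)
  define T where "T = (\<lambda>e. e - 1) ` (E - {m})"
  have "Suc ` T = E - {m}"
  proof -
    have "Suc (e - 1) = e" if "e \<in> E - {m}" for e
      using that by (cases e) (auto simp: m_def)
    then have "(\<lambda>e. Suc (e - 1)) ` (E - {m}) = (\<lambda>e. e) ` (E - {m})"
      by (rule image_cong[OF refl])
    then show ?thesis by (simp add: T_def image_image)
  qed
  then have E: "E = insert m (Suc ` T)" "m \<notin> Suc ` T" using m by auto
  have T: "finite T" using Suc.prems by (simp add: T_def)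
  have "card (insert m (Suc ` T)) = Suc (card T)" using E(2) T by (simp add: card_image)
  then have "n = card T" using Suc.hyps(2) E(1) by simp
  from Suc.hyps(1)[OF this T] obtain a :: "nat \<Rightarrow> 'a"
    where a: "range a \<subseteq> {0, 1}" "a 0 = 1" "rev_toeplitz_inj a T"
    by blast
  show ?case
  proof (cases "0 \<in> E")
    case True
    then have "m = 0" by (simp add: m_def)
    then show ?thesis using a rev_toeplitz_inj_insert_0[OF T a(3,2)] E(1) by blast
  next
    case False
    have "Suc e < m" if "e \<in> T" for e
    proof -
      have "Suc e \<in> E" "Suc e \<noteq> m" using that E by auto
      then show ?thesis using False Suc.prems by (simp add: m_def order_less_le)
    qed
    from rev_toeplitz_inj_insert_greater[OF T a(3) this]
    obtain c where c: "c \<in> {0, 1}" "rev_toeplitz_inj (a(m := c)) E" using E by auto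
    \<comment> \<open>Hence the update at \<open>m\<close> preserves \<open>a 0 = 1\<close>.\<close>
    moreover have "m \<noteq> 0" using False m by metis
    ultimately show ?thesis using a by (intro exI[of _ "a(m := c)"]) auto
  qed
qed

text \<open>Reversing rows and columns turns \<open>i - j\<close> into \<open>e - r\<close> and the
  condition \<open>j \<le> i\<close> into \<open>r \<le> e\<close>; columns outside \<open>D\<close>
  meet zero coordinates of \<open>v\<close>.\<close>

lemma lower_toeplitz_mult_vec_index:
  fixes a :: "nat \<Rightarrow> 'a::field"
  assumes D: "D \<subseteq> {..<N}" and v: "v \<in> coord_subspace N D" and r: "r < N"
  shows "(lower_toeplitz N a *\<^sub>v v) $ (N - 1 - r) =
           rev_toeplitz_row a ((\<lambda>j. N - 1 - j) ` D) (\<lambda>e. v $ (N - 1 - e)) r"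
proof -
  have v': "v \<in> carrier_vec N" "\<And>j. j < N \<Longrightarrow> j \<notin> D \<Longrightarrow> v $ j = 0"
    using v coord_subspace_iff[OF D] by auto
  have inj: "inj_on (\<lambda>j. N - 1 - j) D" by (rule inj_on_subset[OF _ D]) (auto simp: inj_on_def)
  have "(lower_toeplitz N a *\<^sub>v v) $ (N - 1 - r) =
      (\<Sum>j<N. (if j \<le> N - 1 - r then a (N - 1 - r - j) else 0) * v $ j)"
    using r v'(1) by (simp add: lower_toeplitz_def scalar_prod_def lessThan_atLeast0 cong: if_cong)
  also have "\<dots> = (\<Sum>j\<in>D. (if j \<le> N - 1 - r then a (N - 1 - r - j) else 0) * v $ j)"
    using D v'(2) by (intro sum.mono_neutral_right) auto
  also have "\<dots> = rev_toeplitz_row a ((\<lambda>j. N - 1 - j) ` D) (\<lambda>e. v $ (N - 1 - e)) r"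
    unfolding rev_toeplitz_row_def sum.reindex[OF inj] comp_def
  proof (rule sum.cong[OF refl])
    fix j assume "j \<in> D"
    then have "j < N" using D by auto
    then have "N - 1 - (N - 1 - j) = j" "N - 1 - r - j = N - 1 - j - r"
      "j \<le> N - 1 - r \<longleftrightarrow> r \<le> N - 1 - j" using r by auto
    then show "(if j \<le> N - 1 - r then a (N - 1 - r - j) else 0) * v $ j =
        (if r \<le> N - 1 - j then a (N - 1 - j - r) * v $ (N - 1 - (N - 1 - j)) else 0)"
      by simp
  qed
  finally show ?thesis .
qed

theorem theorem1:
  fixes n N :: nat and d :: "nat \<Rightarrow> nat" and D :: "nat set"
  assumes "n > 0"
    and "d 0 = 0"
    and "strict_mono_on {..<n} d"
    and "D = d ` {..<n}"
    and "N = d (n - 1) + 1"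
  shows "\<exists>a :: nat \<Rightarrow> 'a::field.
           (\<forall>i<N. a i \<in> {0, 1}) \<and>
           inj_on (\<lambda>x. vec_last (lower_toeplitz N a *\<^sub>v x) n) (coord_subspace N D)"
proof -
  have "d i \<le> d (n - 1)" if "i < n" for i
    using assms(1) that strict_mono_on_leD[OF assms(3), of i "n - 1"] by auto
  then have D: "D \<subseteq> {..<N}" by (auto simp: assms(4,5) less_Suc_eq_le)
  have cardD: "card D = n"
    using card_image[OF strict_mono_on_imp_inj_on[OF assms(3)]] by (simp add: assms(4))
  have nN: "n \<le> N" using card_mono[OF _ D] cardD by simp
  define E where "E = (\<lambda>j. N - 1 - j) ` D"
  have "inj_on (\<lambda>j. N - 1 - j) D" by (rule inj_on_subset[OF _ D]) (auto simp: inj_on_def)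
  then have cardE: "card E = n" by (simp add: E_def card_image cardD)
  have "finite E" using D finite_subset by (auto simp: E_def)
  from exists_rev_toeplitz_inj[OF this] obtain a :: "nat \<Rightarrow> 'a"
    where a: "range a \<subseteq> {0, 1}" "rev_toeplitz_inj a E" by blast
  have "inj_on (\<lambda>x. vec_last (lower_toeplitz N a *\<^sub>v x) n) (coord_subspace N D)"
  proof (rule inj_onI)
    fix x y assume x: "x \<in> coord_subspace N D" and y: "y \<in> coord_subspace N D"
      and eq: "vec_last (lower_toeplitz N a *\<^sub>v x) n = vec_last (lower_toeplitz N a *\<^sub>v y) n"
    have x': "x \<in> carrier_vec N" "\<And>j. j < N \<Longrightarrow> j \<notin> D \<Longrightarrow> x $ j = 0"
      and y': "y \<in> carrier_vec N" "\<And>j. j < N \<Longrightarrow> j \<notin> D \<Longrightarrow> y $ j = 0"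
      using x y coord_subspace_iff[OF D] by auto
    \<comment> \<open>The factors 1 match the shape of
      \<open>rev_toeplitz_row_diff_scaled\<close>.\<close>
    define z where "z = (\<lambda>e. 1 * x $ (N - 1 - e) - 1 * y $ (N - 1 - e))"
    have "rev_toeplitz_row a E z r = 0" if "r < n" for r
    proof -
      have "vec_last (lower_toeplitz N a *\<^sub>v x) n $ (n - 1 - r) =
          vec_last (lower_toeplitz N a *\<^sub>v y) n $ (n - 1 - r)" using eq by simp
      \<comment> \<open>Counted from the bottom, the last \<open>n\<close> coordinates are exactly
        the rows \<open>r < n\<close>.\<close>
      moreover have "N - n + (n - 1 - r) = N - 1 - r" using nN that by simp
      ultimately have "(lower_toeplitz N a *\<^sub>v x) $ (N - 1 - r) =
          (lower_toeplitz N a *\<^sub>v y) $ (N - 1 - r)"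
        using that by (simp add: vec_last_def lower_toeplitz_def)
      then show ?thesis
        using that nN lower_toeplitz_mult_vec_index[OF D x, of r a]
          lower_toeplitz_mult_vec_index[OF D y, of r a]
        unfolding z_def rev_toeplitz_row_diff_scaled by (simp add: E_def)
    qed
    then have z: "z e = 0" if "e \<in> E" for e
      using a(2) that unfolding rev_toeplitz_inj_def cardE by blast
    show "x = y"
    proof (rule eq_vecI)
      show "dim_vec x = dim_vec y" using x' y' by simp
      fix j assume "j < dim_vec y"
      then have j: "j < N" using y' by simp
      show "x $ j = y $ j"
      proof (cases "j \<in> D")
        case True
        then have "z (N - 1 - j) = 0" by (intro z) (simp add: E_def)
        moreover have "N - 1 - (N - 1 - j) = j" using j by simp
        ultimately show ?thesis by (simp add: z_def)
      qed (simp add: j x' y')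
    qed
  qed
  then show ?thesis using a(1) by blast
qed

end
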